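(* Fix $m\geq 1$ and let $n=2m+r$ with $r\geq 0$. Then the unique optimal graph in $\mathcal{G}_{n,m}$ is $mK_2\cup rK_1$. That is, for $n\geq 2$ and $m<\lceil n/2\rceil$ a unique optimal graph in $\mathcal{G}_{n,m}$ exists.
   Context: All graphs are finite and simple. A set $S$ of vertices of a graph $G$ is dominating if every vertex of $G$ is in $S$ or adjacent to a vertex of $S$. The domination polynomial is $D(G,x)=\sum_{i=1}^{|V(G)|} d(G,i)x^i$, where $d(G,i)$ is the number of dominating sets of $G$ of cardinality $i$. $\mathcal{G}_{n,m}$ denotes the set of simple graphs with $n$ vertices and $m$ edges. A graph $H\in\mathcal{G}_{n,m}$ is optimal if $D(H,x)\geq D(G,x)$ for all $G\in\mathcal{G}_{n,m}$ and all $x\geq 0$; it is the unique optimal graph if it is (up to isomorphism) the only optimal graph in $\mathcal{G}_{n,m}$. $mK_2\cup rK_1$ denotes the disjoint union of $m$ copies of $K_2$ and $r$ isolated vertices. *)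

theory Defs
  imports Complex_Main "HOL-Computational_Algebra.Polynomial"
begin

datatype 'a ugraph = Graph (verts: "'a set") (edges: "'a set set")

definition simple_graph :: "'a ugraph \<Rightarrow> bool" where
  "simple_graph G \<longleftrightarrow> finite (verts G) \<and> (\<forall>e \<in> edges G. e \<subseteq> verts G \<and> card e = 2)"

definition graph_iso :: "'a ugraph \<Rightarrow> 'b ugraph \<Rightarrow> bool" where
  "graph_iso G H \<longleftrightarrow> (\<exists>f. bij_betw f (verts G) (verts H) \<and>
     (\<forall>u \<in> verts G. \<forall>v \<in> verts G. {u, v} \<in> edges G \<longleftrightarrow> {f u, f v} \<in> edges H))"

definition dominating :: "'a ugraph \<Rightarrow> 'a set \<Rightarrow> bool" where
  "dominating G S \<longleftrightarrow> S \<subseteq> verts G \<and>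
     (\<forall>v \<in> verts G. v \<in> S \<or> (\<exists>u \<in> S. {u, v} \<in> edges G))"

definition num_dominating :: "'a ugraph \<Rightarrow> nat \<Rightarrow> nat" where
  "num_dominating G i = card {S. dominating G S \<and> card S = i}"

definition domination_poly :: "'a ugraph \<Rightarrow> real poly" where
  "domination_poly G = (\<Sum>i = 1..card (verts G). monom (of_nat (num_dominating G i)) i)"

text \<open>Vertices are natural numbers and the vertex set is any finite set of them, so that every
  finite simple graph is represented up to isomorphism. Distinct members may be isomorphic.\<close>

definition graphs_nm :: "nat \<Rightarrow> nat \<Rightarrow> nat ugraph set" where
  "graphs_nm n m = {G. simple_graph G \<and> card (verts G) = n \<and> card (edges G) = m}"

definition optimal :: "nat \<Rightarrow> nat \<Rightarrow> nat ugraph \<Rightarrow> bool" where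
  "optimal n m H \<longleftrightarrow> H \<in> graphs_nm n m \<and>
     (\<forall>G \<in> graphs_nm n m. \<forall>x \<ge> 0. poly (domination_poly H) x \<ge> poly (domination_poly G) x)"

definition unique_optimal :: "nat \<Rightarrow> nat \<Rightarrow> nat ugraph \<Rightarrow> bool" where
  "unique_optimal n m H \<longleftrightarrow> optimal n m H \<and> (\<forall>G. optimal n m G \<longrightarrow> graph_iso G H)"

text \<open>\<open>mK\<^sub>2 \<union> rK\<^sub>1\<close>: the \<open>i\<close>-th copy of \<open>K\<^sub>2\<close> sits on the vertices \<open>2i\<close> and \<open>2i+1\<close>, and the
  vertices \<open>2m, \<dots>, 2m+r-1\<close> are isolated.\<close>

definition mK2_rK1 :: "nat \<Rightarrow> nat \<Rightarrow> nat ugraph" where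
  "mK2_rK1 m r = Graph {0..<2 * m + r} ((\<lambda>i. {2 * i, 2 * i + 1}) ` {0..<m})"

end

theory Submission
  imports Defs "HOL-Library.FuncSet"
begin

text \<open>
  If \<open>T\<close> is the complement of a dominating set \<open>S\<close>, choosing for every \<open>v \<in> T\<close> an edge from \<open>v\<close>
  into \<open>S\<close> gives \<open>card T\<close> distinct edges, each with a marked endpoint, and \<open>T\<close> is recovered as the
  set of marked endpoints. So with \<open>m\<close> edges there are at most \<open>(m choose j) * 2 ^ j\<close> dominating sets
  with complement of size \<open>j\<close>. If the edges are pairwise disjoint, every choice of \<open>j\<close> edges with
  marked endpoints arises exactly once, so all these bounds are attained simultaneously. Conversely,
  attaining the bound for \<open>j = 1\<close> means that \<open>2 * m\<close> vertices are not isolated, which forces the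
  \<open>m\<close> edges to be pairwise disjoint.
\<close>

section \<open>Edge sets with marked endpoints\<close>

text \<open>\<open>PiE\<close> fixes a marking to be \<open>undefined\<close> off \<open>A\<close>,
  so each choice of marked endpoints is counted once.\<close>

definition marked_edges :: "'a set set \<Rightarrow> nat \<Rightarrow> ('a set set \<times> ('a set \<Rightarrow> 'a)) set" where
  "marked_edges E j = Sigma {A. A \<subseteq> E \<and> card A = j} (\<lambda>A. PiE A (\<lambda>e. e))"

lemma simple_graph_finite_edges:
  assumes "simple_graph G"
  shows "finite (edges G)"
proof -
  have "edges G \<subseteq> Pow (verts G)" using assms by (auto simp: simple_graph_def)
  then show ?thesis using assms by (auto simp: simple_graph_def intro: finite_subset)
qed

lemma
  assumes "finite E" and "\<And>e. e \<in> E \<Longrightarrow> card e = 2"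
  shows finite_marked_edges: "finite (marked_edges E j)"
    and card_marked_edges: "card (marked_edges E j) = (card E choose j) * 2 ^ j"
proof -
  have fin: "finite {A. A \<subseteq> E \<and> card A = j}" using assms(1) by simp
  have finA: "finite A" if "A \<subseteq> E" for A using that assms(1) finite_subset by blast
  have fine: "finite e" if "e \<in> E" for e
    using assms(2)[OF that] card.infinite by fastforce
  have finP: "finite (PiE A (\<lambda>e. e))" if "A \<subseteq> E" for A
    using finA[OF that] fine that by (intro finite_PiE) auto
  show "finite (marked_edges E j)"
    unfolding marked_edges_def using fin finP by (intro finite_SigmaI) auto
  have "card (PiE A (\<lambda>e. e)) = 2 ^ j" if "A \<subseteq> E" "card A = j" for A
  proof -
    have "(\<Prod>e\<in>A. card e) = (\<Prod>e\<in>A. 2)" using assms(2) that by (intro prod.cong) auto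
    then show ?thesis using card_PiE[OF finA[OF that(1)], of "\<lambda>e. e"] that by simp
  qed
  then show "card (marked_edges E j) = (card E choose j) * 2 ^ j"
    unfolding marked_edges_def using fin finP n_subsets[OF assms(1), of j]
    by (subst card_SigmaI) auto
qed

section \<open>The upper bound on the number of dominating sets\<close>

lemma dominating_complement_marked_edges:
  assumes G: "simple_graph G" and S: "dominating G S"
  shows "\<exists>(A, c) \<in> marked_edges (edges G) (card (verts G - S)). S = verts G - c ` A"
proof -
  define T where "T = verts G - S"
  have "\<exists>u. u \<in> S \<and> {u, v} \<in> edges G" if "v \<in> T" for v
    using S that unfolding dominating_def T_def by auto
  then obtain g where g: "\<And>v. v \<in> T \<Longrightarrow> g v \<in> S \<and> {g v, v} \<in> edges G"
    by metis
  define h where "h = (\<lambda>v. {g v, v})"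
  \<comment> \<open>If \<open>h v = h v'\<close> with \<open>v\<close> and \<open>v'\<close>
    distinct, then \<open>g v = v'\<close>, but \<open>g v\<close> lies in \<open>S\<close> and
    \<open>v'\<close> does not.\<close>
  have inj: "inj_on h T"
    by (rule inj_onI) (use g in \<open>auto simp: h_def T_def doubleton_eq_iff\<close>)
  define c where "c = restrict (inv_into T h) (h ` T)"
  have c: "c (h v) = v" if "v \<in> T" for v
    using that inj by (simp add: c_def)
  have "c ` h ` T = T" using c by (auto simp: image_image)
  moreover have "(h ` T, c) \<in> marked_edges (edges G) (card T)"
  proof -
    have "c \<in> PiE (h ` T) (\<lambda>e. e)"
    proof (rule PiE_I)
      fix e assume "e \<in> h ` T"
      then show "c e \<in> e" using c by (auto simp: h_def)
    qed (simp add: c_def)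
    then show ?thesis
      using g inj by (auto simp: marked_edges_def card_image h_def)
  qed
  moreover have "S = verts G - T"
    using S by (auto simp: dominating_def T_def)
  ultimately show ?thesis unfolding T_def by (intro bexI[of _ "(h ` T, c)"]) (auto simp: T_def)
qed

text \<open>The marked edge sets only cover the dominating sets: several markings may yield the same
  complement, and some yield sets that do not dominate. Hence an inequality.\<close>

lemma num_dominating_le:
  assumes G: "simple_graph G" and "i \<le> card (verts G)"
  shows "num_dominating G i \<le>
    (card (edges G) choose (card (verts G) - i)) * 2 ^ (card (verts G) - i)"
proof -
  let ?M = "marked_edges (edges G) (card (verts G) - i)"
  have "\<And>e. e \<in> edges G \<Longrightarrow> card e = 2" using G by (auto simp: simple_graph_def)
  note finM = finite_marked_edges[OF simple_graph_finite_edges[OF G] this]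
    and cardM = card_marked_edges[OF simple_graph_finite_edges[OF G] this]
  have "{S. dominating G S \<and> card S = i} \<subseteq> (\<lambda>(A, c). verts G - c ` A) ` ?M"
  proof
    fix S assume "S \<in> {S. dominating G S \<and> card S = i}"
    then have S: "dominating G S" "card S = i" by auto
    have "S \<subseteq> verts G" "finite (verts G)"
      using S G by (auto simp: dominating_def simple_graph_def)
    then have "card (verts G - S) = card (verts G) - i"
      using S by (metis card_Diff_subset finite_subset)
    then show "S \<in> (\<lambda>(A, c). verts G - c ` A) ` ?M"
      using dominating_complement_marked_edges[OF G S(1)] by force
  qed
  then show ?thesis
    unfolding num_dominating_def using surj_card_le[OF finM] by (simp add: cardM)
qed

section \<open>Equality for pairwise disjoint edges\<close>

lemma num_dominating_disjoint_edges:
  assumes G: "simple_graph G" and disj: "pairwise disjnt (edges G)" and i: "i \<le> card (verts G)"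
  shows "num_dominating G i =
    (card (edges G) choose (card (verts G) - i)) * 2 ^ (card (verts G) - i)"
proof (rule antisym[OF num_dominating_le[OF G i]])
  let ?j = "card (verts G) - i"
  let ?M = "marked_edges (edges G) ?j"
  let ?f = "\<lambda>(A, c). verts G - c ` A"
  have finV: "finite (verts G)"
    and E: "\<And>e. e \<in> edges G \<Longrightarrow> e \<subseteq> verts G \<and> card e = 2"
    using G by (auto simp: simple_graph_def)
  \<comment> \<open>Disjointness enters in this form: an edge is determined by any one of its
    vertices.\<close>
  have uniq: "e = e'" if "e \<in> edges G" "e' \<in> edges G" "v \<in> e" "v \<in> e'" for e e' v
    using disj that by (auto simp: pairwise_def disjnt_def)
  have M: "A \<subseteq> edges G \<and> card A = ?j \<and> c \<in> extensional A \<and> (\<forall>e\<in>A. c e \<in> e)"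
    if "(A, c) \<in> ?M" for A c
    using that by (auto simp: marked_edges_def PiE_iff)
  have sub: "c ` A \<subseteq> verts G" if "(A, c) \<in> ?M" for A c
    using M[OF that] E by blast
  have "inj_on ?f ?M"
  proof (rule inj_onI, clarify)
    fix A c A' c'
    assume m: "(A, c) \<in> ?M" "(A', c') \<in> ?M" and "verts G - c ` A = verts G - c' ` A'"
    then have eq: "c ` A = c' ` A'" using sub[OF m(1)] sub[OF m(2)] by blast
    \<comment> \<open>The vertex that \<open>d\<close> marks on \<open>e\<close> is marked by
      \<open>b\<close> on some \<open>e'\<close>, and \<open>e' = e\<close> because both contain it.
      Using this in both directions recovers the edge set and the marking.\<close>
    have 1: "e \<in> B \<and> d e = b e" if "(A, d) \<in> ?M" "(B, b) \<in> ?M" "d ` A = b ` B" "e \<in> A" for A d B b e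
    proof -
      obtain e' where "e' \<in> B" "d e = b e'" using \<open>d ` A = b ` B\<close> \<open>e \<in> A\<close> by blast
      moreover from this have "e = e'"
        using M[OF that(1)] M[OF that(2)] that(4) by (intro uniq[of e e' "d e"]) auto
      ultimately show ?thesis by simp
    qed
    have "A = A'" using 1[OF m eq] 1[OF m(2) m(1) eq[symmetric]] by blast
    moreover have "c = c'"
      using 1[OF m eq] M[OF m(1)] M[OF m(2)] \<open>A = A'\<close> by (auto intro: extensionalityI)
    ultimately show "A = A' \<and> c = c'" by simp
  qed
  moreover have "?f ` ?M \<subseteq> {S. dominating G S \<and> card S = i}"
  proof clarify
    fix A c assume m: "(A, c) \<in> ?M"
    note M = M[OF m]
    have "inj_on c A"
      by (rule inj_onI) (metis M subsetD uniq)
    then have "card (verts G - c ` A) = i"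
      using M i sub[OF m] finV by (simp add: card_Diff_subset finite_subset card_image)
    moreover have "dominating G (verts G - c ` A)"
      unfolding dominating_def
    proof (intro conjI ballI)
      fix v assume v: "v \<in> verts G"
      show "v \<in> verts G - c ` A \<or> (\<exists>u\<in>verts G - c ` A. {u, v} \<in> edges G)"
      proof (cases "v \<in> c ` A")
        case True
        then obtain e where e: "e \<in> A" "v = c e" by blast
        then have "e \<in> edges G" "v \<in> e" using M by auto
        then obtain u where u: "e = {u, v}" "u \<noteq> v"
          using E[of e] by (auto simp: card_2_iff)
        \<comment> \<open>The partner \<open>u\<close> of a removed vertex \<open>v\<close> survives
          and dominates it: a chosen edge marking \<open>u\<close> would be \<open>e\<close>, whose
          mark is \<open>v\<close>.\<close>
        have "u \<notin> c ` A"
        proof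
          assume "u \<in> c ` A"
          then obtain e' where "e' \<in> A" "u = c e'" by blast
          then have "e' = e" using M u \<open>e \<in> edges G\<close> by (intro uniq[of e' e u]) auto
          then show False using \<open>u = c e'\<close> e(2) u(2) by simp
        qed
        then show ?thesis using u \<open>e \<in> edges G\<close> E[of e] by auto
      qed (use v in simp)
    qed auto
    ultimately show "dominating G (verts G - c ` A) \<and> card (verts G - c ` A) = i" by simp
  qed
  moreover have "finite {S. dominating G S \<and> card S = i}"
    using finV by (auto intro: finite_subset[of _ "Pow (verts G)"] simp: dominating_def)
  ultimately have "card ?M \<le> num_dominating G i"
    unfolding num_dominating_def by (rule card_inj_on_le)
  then show "(card (edges G) choose ?j) * 2 ^ ?j \<le> num_dominating G i"
    using card_marked_edges[of "edges G" ?j] simple_graph_finite_edges[OF G] E by simp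
qed

section \<open>Complements of size one\<close>

text \<open>The single missing vertex needs a neighbour, so it is not isolated. This refines the
  general bound \<open>2 * card (edges G)\<close>, since a vertex shared by several edges counts
  once.\<close>

lemma num_dominating_pred_le_card_Union_edges:
  assumes G: "simple_graph G" and "card (verts G) \<ge> 1"
  shows "num_dominating G (card (verts G) - 1) \<le> card (\<Union>(edges G))"
proof -
  have fin: "finite (verts G)" and sub: "\<Union>(edges G) \<subseteq> verts G"
    using G by (auto simp: simple_graph_def)
  have "{S. dominating G S \<and> card S = card (verts G) - 1} \<subseteq> (\<lambda>v. verts G - {v}) ` \<Union>(edges G)"
  proof clarify
    fix S assume S: "dominating G S" "card S = card (verts G) - 1"
    then have "S \<subseteq> verts G" by (simp add: dominating_def)
    then have "card (verts G - S) = 1"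
      using S assms fin by (simp add: card_Diff_subset finite_subset)
    then obtain v where v: "verts G - S = {v}" by (auto simp: card_1_singleton_iff)
    then obtain u where "{u, v} \<in> edges G" using S by (auto simp: dominating_def)
    moreover have "S = verts G - {v}" using v \<open>S \<subseteq> verts G\<close> by auto
    ultimately show "S \<in> (\<lambda>v. verts G - {v}) ` \<Union>(edges G)" by blast
  qed
  then show ?thesis
    unfolding num_dominating_def
    using surj_card_le finite_subset[OF sub fin] by blast
qed

text \<open>If \<open>e\<close> and \<open>f\<close> met in \<open>w\<close>, then \<open>f\<close>
  would add at most one vertex to the at most \<open>2 * (card E - 1)\<close> vertices of the other
  edges, too few for the assumed bound.\<close>

lemma pairwise_disjnt_of_card_Union:
  assumes fin: "finite E" and E: "\<And>e. e \<in> E \<Longrightarrow> card e = 2" and ge: "card (\<Union>E) \<ge> 2 * card E"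
  shows "pairwise disjnt E"
proof (rule ccontr)
  assume "\<not> pairwise disjnt E"
  then obtain e f w where ef: "e \<in> E" "f \<in> E" "e \<noteq> f" "w \<in> e" "w \<in> f"
    by (auto simp: pairwise_def disjnt_def)
  have finE: "finite e" if "e \<in> E" for e using E[OF that] card.infinite by fastforce
  have pos: "card E > 0" using fin ef by (auto simp: card_gt_0_iff)
  have "\<Union>E \<subseteq> \<Union>(E - {f}) \<union> (f - {w})" using ef by auto
  then have "card (\<Union>E) \<le> card (\<Union>(E - {f}) \<union> (f - {w}))"
    using fin finE ef by (intro card_mono) auto
  also have "\<dots> \<le> card (\<Union>(E - {f})) + card (f - {w})" by (rule card_Un_le)
  also have "card (\<Union>(E - {f})) \<le> (\<Sum>e\<in>E - {f}. card e)"
    by (rule card_Union_le_sum_card)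
  also have "(\<Sum>e\<in>E - {f}. card e) = 2 * (card E - 1)" using E fin ef by simp
  also have "card (f - {w}) = 1" using E ef by simp
  finally show False using ge pos by linarith
qed

section \<open>Values and coefficients of the domination polynomial\<close>

lemma poly_domination_poly:
  "poly (domination_poly G) x = (\<Sum>i = 1..card (verts G). real (num_dominating G i) * x ^ i)"
  by (simp add: domination_poly_def poly_sum poly_monom)

lemma coeff_domination_poly:
  assumes "1 \<le> i" "i \<le> card (verts G)"
  shows "coeff (domination_poly G) i = real (num_dominating G i)"
  using assms by (simp add: domination_poly_def coeff_sum)

section \<open>Graphs with disjoint edges up to isomorphism\<close>

text \<open>The map that is easy to construct numbers the vertices of \<open>G\<close> by those of
  the concrete graph \<open>H\<close>; its inverse is the map that \<open>graph_iso G H\<close> asks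
  for.\<close>

lemma graph_iso_image_edges:
  assumes f: "bij_betw f (verts H) (verts G)" and H: "\<And>e. e \<in> edges H \<Longrightarrow> e \<subseteq> verts H"
    and E: "edges G = (`) f ` edges H"
  shows "graph_iso G H"
proof -
  define g where "g = inv_into (verts H) f"
  have g: "bij_betw g (verts G) (verts H)" using f by (simp add: g_def bij_betw_inv_into)
  have fg: "f (g v) = v" if "v \<in> verts G" for v
    using f that by (simp add: g_def bij_betw_inv_into_right)
  have inj: "inj_on f (verts H)" using f by (rule bij_betw_imp_inj_on)
  have "{u, v} \<in> edges G \<longleftrightarrow> {g u, g v} \<in> edges H" if "u \<in> verts G" "v \<in> verts G" for u v
  proof -
    have sub: "{g u, g v} \<subseteq> verts H" using g that by (auto dest: bij_betwE)
    have "inj_on ((`) f) (Pow (verts H))" using inj by (rule inj_on_image_Pow)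
    moreover have "edges H \<subseteq> Pow (verts H)" using H by auto
    ultimately have "f ` {g u, g v} \<in> edges G \<longleftrightarrow> {g u, g v} \<in> edges H"
      unfolding E using sub by (intro inj_on_image_mem_iff) auto
    then show ?thesis using fg that by simp
  qed
  then show ?thesis using g by (auto simp: graph_iso_def)
qed

lemma simple_graph_mK2_rK1: "simple_graph (mK2_rK1 m r)"
  by (auto simp: simple_graph_def mK2_rK1_def)

lemma disjoint_edges_mK2_rK1: "pairwise disjnt (edges (mK2_rK1 m r))"
  by (auto simp: pairwise_def disjnt_def mK2_rK1_def) presburger+

lemma mK2_rK1_in_graphs_nm: "mK2_rK1 m r \<in> graphs_nm (2 * m + r) m"
proof -
  have "inj_on (\<lambda>i::nat. {2 * i, 2 * i + 1}) {0..<m}"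
    by (rule inj_onI) (auto simp: doubleton_eq_iff)
  then show ?thesis
    using simple_graph_mK2_rK1 by (simp add: graphs_nm_def mK2_rK1_def card_image)
qed

lemma graph_iso_mK2_rK1:
  assumes G: "simple_graph G" and disj: "pairwise disjnt (edges G)"
    and m: "card (edges G) = m" and n: "card (verts G) = 2 * m + r"
  shows "graph_iso G (mK2_rK1 m r)"
proof -
  have finV: "finite (verts G)" and E: "\<And>e. e \<in> edges G \<Longrightarrow> e \<subseteq> verts G \<and> card e = 2"
    using G by (auto simp: simple_graph_def)
  have finE: "finite e" if "e \<in> edges G" for e using E[OF that] finV finite_subset by blast
  have sub: "\<Union>(edges G) \<subseteq> verts G" using E by blast
  have "card (\<Union>(edges G)) = (\<Sum>e\<in>edges G. card e)"
    using disj finE by (rule card_Union_disjoint)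
  also have "\<dots> = 2 * m" using E m by simp
  finally have "card (verts G - \<Union>(edges G)) = r"
    using n finV sub by (simp add: card_Diff_subset finite_subset)
  then obtain h where h: "bij_betw h {0..<r} (verts G - \<Union>(edges G))"
    using ex_bij_betw_nat_finite[of "verts G - \<Union>(edges G)"] finV by auto
  obtain p where p: "bij_betw p {0..<m} (edges G)"
    using ex_bij_betw_nat_finite[OF simple_graph_finite_edges[OF G]] m by auto
  have pE: "p i \<in> edges G" if "i < m" for i using p that by (auto dest: bij_betwE)
  have "\<exists>a b. p i = {a, b} \<and> a \<noteq> b" if "i < m" for i
    using E[OF pE[OF that]] by (auto simp: card_2_iff)
  then obtain a b where ab: "\<And>i. i < m \<Longrightarrow> p i = {a i, b i} \<and> a i \<noteq> b i"
    by metis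
  \<comment> \<open>The ends of the edge \<open>p i\<close> receive the numbers \<open>2 * i\<close>
    and \<open>2 * i + 1\<close>; the isolated vertices, enumerated by \<open>h\<close>,
    follow.\<close>
  define f where "f k = (if k < 2 * m then if even k then a (k div 2) else b (k div 2)
    else h (k - 2 * m))" for k
  have f1: "f k \<in> p (k div 2)" if "k < 2 * m" for k
    using ab[of "k div 2"] that by (auto simp: f_def)
  have f2: "f k \<in> verts G - \<Union>(edges G)" if "2 * m \<le> k" "k < 2 * m + r" for k
  proof -
    have "k - 2 * m \<in> {0..<r}" using that by auto
    then show ?thesis using that h by (auto simp: f_def dest: bij_betwE)
  qed
  have inU: "f k \<in> \<Union>(edges G)" if "k < 2 * m" for k
    using f1[OF that] pE[of "k div 2"] that by auto
  have inj: "inj_on f {0..<2 * m + r}"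
  proof (rule inj_onI)
    fix k l assume kl: "k \<in> {0..<2 * m + r}" "l \<in> {0..<2 * m + r}" "f k = f l"
    \<comment> \<open>No mixed case arises: numbers below \<open>2 * m\<close> go to non-isolated
      vertices, the others to isolated ones.\<close>
    consider "k < 2 * m" "l < 2 * m" | "2 * m \<le> k" "2 * m \<le> l"
      using kl inU[of k] inU[of l] f2[of k] f2[of l] by fastforce
    then show "k = l"
    proof cases
      case 1
      have "p (k div 2) \<in> edges G" "p (l div 2) \<in> edges G" using pE 1 by auto
      then have "p (k div 2) = p (l div 2)"
        using f1[OF 1(1)] f1[OF 1(2)] kl(3) disj by (auto simp: pairwise_def disjnt_iff)
      then have eq: "k div 2 = l div 2"
        using p 1 by (auto simp: bij_betw_def inj_on_def)
      \<comment> \<open>On a common edge the parity decides between the two distinct ends.\<close>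
      moreover have "even k \<longleftrightarrow> even l"
        using kl(3) 1 eq ab[of "l div 2"] by (auto simp: f_def split: if_splits)
      ultimately show ?thesis by presburger
    next
      case 2
      then have "k - 2 * m = l - 2 * m"
        using kl h by (intro inj_onD[OF bij_betw_imp_inj_on[OF h]]) (auto simp: f_def)
      then show ?thesis using 2 by simp
    qed
  qed
  have "f k \<in> verts G" if "k < 2 * m + r" for k
    using that inU[of k] f2[of k] sub by (cases "k < 2 * m") auto
  then have "f ` {0..<2 * m + r} \<subseteq> verts G" by auto
  then have "f ` {0..<2 * m + r} = verts G"
    using finV n inj by (intro card_subset_eq) (auto simp: card_image)
  then have bij: "bij_betw f (verts (mK2_rK1 m r)) (verts G)"
    using inj by (simp add: bij_betw_def mK2_rK1_def)
  have "f ` {2 * i, 2 * i + 1} = p i" if "i < m" for i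
    using ab[OF that] that by (auto simp: f_def)
  then have "(`) f ` edges (mK2_rK1 m r) = p ` {0..<m}"
    by (simp add: mK2_rK1_def image_image del: image_insert cong: image_cong_simp)
  also have "\<dots> = edges G" using p by (simp add: bij_betw_def)
  finally have "edges G = (`) f ` edges (mK2_rK1 m r)" by simp
  then show ?thesis
    using bij simple_graph_mK2_rK1 by (intro graph_iso_image_edges) (auto simp: simple_graph_def)
qed

section \<open>Optimality and uniqueness\<close>

lemma optimal_mK2_rK1: "optimal (2 * m + r) m (mK2_rK1 m r)"
proof -
  let ?H = "mK2_rK1 m r"
  have H: "card (verts ?H) = 2 * m + r" "card (edges ?H) = m"
    using mK2_rK1_in_graphs_nm[of m r] by (auto simp: graphs_nm_def)
  have "poly (domination_poly G) x \<le> poly (domination_poly ?H) x"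
    if "G \<in> graphs_nm (2 * m + r) m" "x \<ge> 0" for G and x :: real
  proof -
    have G: "simple_graph G" "card (verts G) = 2 * m + r" "card (edges G) = m"
      using that by (auto simp: graphs_nm_def)
    have "num_dominating G i \<le> num_dominating ?H i" if "i \<le> 2 * m + r" for i
      using num_dominating_le[OF G(1), of i]
        num_dominating_disjoint_edges[OF simple_graph_mK2_rK1 disjoint_edges_mK2_rK1, of i m r]
        that G H by simp
    then show ?thesis
      unfolding poly_domination_poly G H using \<open>x \<ge> 0\<close>
      by (intro sum_mono mult_right_mono) auto
  qed
  then show ?thesis using mK2_rK1_in_graphs_nm by (auto simp: optimal_def)
qed

text \<open>Optimality of both graphs gives both inequalities at every \<open>x \<ge> 0\<close>, and
  polynomials that agree at infinitely many points are equal.\<close>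

lemma optimal_domination_poly_eq:
  assumes G: "optimal n m G" and H: "optimal n m H"
  shows "domination_poly G = domination_poly H"
proof -
  have "poly (domination_poly G - domination_poly H) x = 0" if "x \<ge> 0" for x
    using G H that by (auto simp: optimal_def intro: antisym)
  then have "{0..} \<subseteq> {x. poly (domination_poly G - domination_poly H) x = 0}" by auto
  then have "infinite {x. poly (domination_poly G - domination_poly H) x = 0}"
    using infinite_Ici finite_subset by blast
  then show ?thesis by (metis eq_iff_diff_eq_0 poly_roots_finite)
qed

text \<open>The polynomial of \<open>G\<close> must be that of \<open>mK2_rK1 m r\<close>; its
  coefficient one below the number of vertices forces \<open>2 * m\<close> non-isolated
  vertices.\<close>

lemma optimal_imp_disjoint_edges:
  assumes "optimal (2 * m + r) m G"
  shows "pairwise disjnt (edges G)"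
proof (rule pairwise_disjnt_of_card_Union)
  let ?H = "mK2_rK1 m r"
  have G: "simple_graph G" "card (verts G) = 2 * m + r" "card (edges G) = m"
    using assms by (auto simp: optimal_def graphs_nm_def)
  have H: "card (verts ?H) = 2 * m + r" "card (edges ?H) = m"
    using mK2_rK1_in_graphs_nm[of m r] by (auto simp: graphs_nm_def)
  show "finite (edges G)" "\<And>e. e \<in> edges G \<Longrightarrow> card e = 2"
    using G simple_graph_finite_edges by (auto simp: simple_graph_def)
  show "2 * card (edges G) \<le> card (\<Union>(edges G))"
  proof (cases "m = 0")
    case False
    \<comment> \<open>The polynomial only records sizes from 1 on; a positive \<open>m\<close> puts
      \<open>?i\<close> in that range.\<close>
    let ?i = "2 * m + r - 1"
    have i: "1 \<le> ?i" "?i \<le> 2 * m + r" "2 * m + r - ?i = 1" using False by auto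
    have "2 * m = num_dominating ?H ?i"
      using num_dominating_disjoint_edges[OF simple_graph_mK2_rK1 disjoint_edges_mK2_rK1, of ?i m r]
        H i by simp
    also have "\<dots> = num_dominating G ?i"
      using optimal_domination_poly_eq[OF assms optimal_mK2_rK1]
        coeff_domination_poly[of ?i G] coeff_domination_poly[of ?i ?H] G H i by simp
    also have "\<dots> \<le> card (\<Union>(edges G))"
      using num_dominating_pred_le_card_Union_edges[OF G(1)] G False by simp
    finally show ?thesis using G by simp
  qed (use G in simp)
qed

text \<open>The case \<open>m = 0\<close> is included because the existence claim of the theorem
  covers it.\<close>

lemma unique_optimal_mK2_rK1: "unique_optimal (2 * m + r) m (mK2_rK1 m r)"
  unfolding unique_optimal_def
proof (intro conjI allI impI)
  fix G assume G: "optimal (2 * m + r) m G"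
  then have "simple_graph G" "card (edges G) = m" "card (verts G) = 2 * m + r"
    by (auto simp: optimal_def graphs_nm_def)
  then show "graph_iso G (mK2_rK1 m r)"
    using optimal_imp_disjoint_edges[OF G] by (intro graph_iso_mK2_rK1)
qed (rule optimal_mK2_rK1)

theorem theorem2p5:
  "(\<forall>m r :: nat. m \<ge> 1 \<longrightarrow> unique_optimal (2 * m + r) m (mK2_rK1 m r)) \<and>
   (\<forall>n m :: nat. n \<ge> 2 \<and> int m < \<lceil>real n / 2\<rceil> \<longrightarrow> (\<exists>H. unique_optimal n m H))"
proof (intro conjI allI impI)
  fix n m :: nat
  assume "n \<ge> 2 \<and> int m < \<lceil>real n / 2\<rceil>"
  \<comment> \<open>An integer is below the ceiling of \<open>real n / 2\<close> exactly if it is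
    below \<open>real n / 2\<close> itself. Hence the subtraction \<open>n - 2 * m\<close>, which
    supplies \<open>r\<close>, is not truncated.\<close>
  then have "2 * m \<le> n" by (simp add: less_ceiling_iff)
  then show "\<exists>H. unique_optimal n m H"
    using unique_optimal_mK2_rK1[of m "n - 2 * m"] by auto
qed (rule unique_optimal_mK2_rK1)

end
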